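(* Let $r\geq 1$ be an integer and let $t=27720r+169$. Then for every integer $n\geq \frac{6911}{16}t^{2}+\frac{514441}{8}t-\frac{3309665}{16}$, we have $f(n)\geq n+32t-1$.
   Context: For a positive integer $n$, $f(n)$ denotes the maximum number of edges in a (simple, finite) graph on $n$ vertices in which no two distinct cycles have the same length. *)

theory Defs
  imports Complex_Main
begin

definition simple_graph_on :: "nat \<Rightarrow> nat set set \<Rightarrow> bool" where
  "simple_graph_on n E \<longleftrightarrow> E \<subseteq> {e. \<exists>u v. u \<noteq> v \<and> u < n \<and> v < n \<and> e = {u, v}}"

definition cycle_edges :: "nat list \<Rightarrow> nat set set" where
  "cycle_edges vs = {{vs ! i, vs ! ((i + 1) mod length vs)} | i. i < length vs}"

definition is_cycle :: "nat set set \<Rightarrow> nat set set \<Rightarrow> bool" where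
  "is_cycle E C \<longleftrightarrow> (\<exists>vs. length vs \<ge> 3 \<and> distinct vs \<and> C = cycle_edges vs \<and> C \<subseteq> E)"

definition distinct_cycle_lengths :: "nat set set \<Rightarrow> bool" where
  "distinct_cycle_lengths E \<longleftrightarrow>
     (\<forall>C1 C2. is_cycle E C1 \<and> is_cycle E C2 \<and> C1 \<noteq> C2 \<longrightarrow> card C1 \<noteq> card C2)"

definition f :: "nat \<Rightarrow> nat" where
  "f n = Max {card E | E. simple_graph_on n E \<and> distinct_cycle_lengths E}"

end

theory Submission
  imports Defs
begin

text \<open>
  Join a hub vertex 0 to some vertices \<^term>\<open>N\<close> of a forest. Every cycle passes through the hub and is
  determined by its two neighbours there, which lie in one tree of the forest; its length is their
  distance plus 2. If the trees are caterpillars and \<^term>\<open>N\<close> consists of their leaves, each tree becomes a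
  fan with spokes \<open>s\<^sub>0, \<dots>, s\<^sub>m\<close> and rim segments \<open>r\<^sub>1, \<dots>, r\<^sub>m\<close>, which has \<open>m\<close> edges more than non-hub
  vertices and the cycle lengths \<open>s\<^sub>i + s\<^sub>j + r\<^sub>i\<^sub>+\<^sub>1 + \<dots> + r\<^sub>j\<close> for \<open>i < j\<close>.

  Three families of fans with \<open>m = 5, 5, 4\<close> and 21 families of single cycles, each with \<open>K\<close> members, have
  pairwise distinct cycle lengths. They give \<open>35 K\<close> excess edges on about \<open>516.5 K\<^sup>2\<close> vertices. With
  \<open>K \<approx> 32 t / 35\<close> that is about \<open>431.75 t\<^sup>2\<close> vertices, whereas \<open>6911 / 16 = 431.9375\<close>.
\<close>

subsection \<open>A forest joined to a hub\<close>

fun path_edges :: "'a list \<Rightarrow> 'a set set" where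
  "path_edges (x # y # zs) = insert {x, y} (path_edges (y # zs))"
| "path_edges _ = {}"

lemma path_edges_append: "path_edges (xs @ y # zs) = path_edges (xs @ [y]) \<union> path_edges (y # zs)"
proof (induction xs)
  case (Cons x xs)
  then show ?case by (cases xs) auto
qed simp

lemma path_edges_snoc:
  "xs \<noteq> [] \<Longrightarrow> path_edges (xs @ [x]) = insert {last xs, x} (path_edges xs)"
  by (induction xs rule: path_edges.induct) auto

lemma path_edges_conv_nth: "path_edges xs = {{xs ! i, xs ! Suc i} | i. Suc i < length xs}"
proof (induction xs rule: path_edges.induct)
  case (1 x y zs)
  have ex0: "(\<exists>i. Q i) \<longleftrightarrow> Q 0 \<or> (\<exists>i. Q (Suc i))" for Q :: "nat \<Rightarrow> bool"
    by (metis not0_implies_Suc)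
  have "{{(x # y # zs) ! i, (x # y # zs) ! Suc i} | i. Suc i < length (x # y # zs)} =
    insert {x, y} {{(y # zs) ! i, (y # zs) ! Suc i} | i. Suc i < length (y # zs)}" (is "?L = ?R")
  proof (rule set_eqI)
    fix e
    have "e \<in> ?L \<longleftrightarrow> (\<exists>i. Suc i < length (x # y # zs) \<and> e = {(x # y # zs) ! i, (x # y # zs) ! Suc i})"
      by auto
    also have "\<dots> \<longleftrightarrow> e \<in> ?R"
      using ex0[of "\<lambda>i. Suc i < length (x # y # zs) \<and> e = {(x # y # zs) ! i, (x # y # zs) ! Suc i}"]
      by auto
    finally show "e \<in> ?L \<longleftrightarrow> e \<in> ?R" .
  qed
  with 1 show ?case by simp
qed auto

lemma cycle_edges_Cons: "cycle_edges (x # xs) = path_edges (x # xs @ [x])"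
proof -
  have "{(x # xs) ! i, (x # xs) ! ((i + 1) mod length (x # xs))} =
      {(x # xs @ [x]) ! i, (x # xs @ [x]) ! Suc i}" if "i < length (x # xs)" for i
  proof (cases "i = length xs")
    case True
    then show ?thesis by (auto simp: nth_append nth_Cons split: nat.splits)
  next
    case False
    with that show ?thesis by (auto simp: nth_append nth_Cons split: nat.splits)
  qed
  then show ?thesis
    unfolding cycle_edges_def path_edges_conv_nth by (auto; metis)
qed

text \<open>Used to start a cycle at the hub, so that the remaining vertices form a path in the
  forest.\<close>

lemma cycle_edges_rotate_to:
  assumes "x \<in> set vs"
  obtains w where "cycle_edges vs = cycle_edges (x # w)" "set vs = set (x # w)" "length vs = length (x # w)"
proof -
  obtain xs ys where vs: "vs = xs @ x # ys" using split_list[OF assms] by blast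
  have "cycle_edges vs = cycle_edges (x # ys @ xs)"
  proof (cases xs)
    case (Cons z zs)
    have "cycle_edges vs = path_edges ((xs @ [x]) @ ys @ [z])"
      by (simp add: vs Cons cycle_edges_Cons)
    also have "\<dots> = path_edges (xs @ [x]) \<union> path_edges ((x # ys) @ [z])"
      using path_edges_append[of xs x "ys @ [z]"] by simp
    also have "\<dots> = path_edges ((x # ys) @ z # (zs @ [x]))"
      using path_edges_append[of "x # ys" z "zs @ [x]"] Cons by auto
    finally show ?thesis by (simp add: Cons cycle_edges_Cons)
  qed (simp add: vs)
  then show ?thesis by (rule that) (auto simp: vs)
qed

lemma sym_diff_insert:
  assumes "sym_diff A B = {k}" "k \<notin> sym_diff B C"
  shows "sym_diff A C = insert k (sym_diff B C)"
proof (rule set_eqI)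
  fix z
  have "z \<in> A \<longleftrightarrow> (z \<in> B \<longleftrightarrow> z \<noteq> k)" using assms(1) by auto
  then show "z \<in> sym_diff A C \<longleftrightarrow> z \<in> insert k (sym_diff B C)"
    using assms(2) by auto
qed

text \<open>\<open>P u\<close> is meant as the set of edges from \<open>u\<close> to the root of its
  tree, and \<open>comp u\<close> as the label of that tree. Acyclicity enters only in this form:
  the sets \<open>P\<close> at the two ends of \<open>k\<close> differ in exactly
  \<open>k\<close>.\<close>

locale hub_forest =
  fixes K :: "'k set" and ed :: "'k \<Rightarrow> nat set" and P :: "nat \<Rightarrow> 'k set"
    and comp :: "nat \<Rightarrow> 'c" and N :: "nat set"
  assumes edge: "k \<in> K \<Longrightarrow> 0 \<notin> ed k \<and>
    (\<exists>u v. ed k = {u, v} \<and> comp u = comp v \<and> sym_diff (P u) (P v) = {k})"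
    and hub_notin: "0 \<notin> N"
begin

definition edges :: "nat set set" where
  "edges = ed ` K \<union> (\<lambda>a. {0, a}) ` N"

lemma edge_ends:
  assumes "k \<in> K" "ed k = {u, v}"
  shows "comp u = comp v" "sym_diff (P u) (P v) = {k}"
  using edge[OF assms(1)] unfolding assms(2) doubleton_eq_iff by auto

lemma inj_on_ed: "inj_on ed K"
proof (rule inj_onI)
  fix k l assume k: "k \<in> K" and l: "l \<in> K" and eq: "ed k = ed l"
  obtain u v where uv: "ed k = {u, v}" using edge[OF k] by blast
  have "sym_diff (P u) (P v) = {k}" by (rule edge_ends(2)[OF k uv])
  moreover have "sym_diff (P u) (P v) = {l}" by (rule edge_ends(2)[OF l]) (use eq uv in simp)
  ultimately show "k = l" by auto
qed

text \<open>Each edge toggles exactly itself in \<open>P\<close>. A path with distinct vertices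
  repeats no edge, so nothing cancels and the difference of \<open>P\<close> at its ends is its edge
  set.\<close>

lemma path_avoiding_hub:
  assumes "w \<noteq> []" "distinct w" "0 \<notin> set w" "path_edges w \<subseteq> edges"
  shows "sym_diff (P (hd w)) (P (last w)) \<subseteq> K \<and> comp (hd w) = comp (last w) \<and>
    path_edges w = ed ` sym_diff (P (hd w)) (P (last w))"
  using assms
proof (induction w rule: path_edges.induct)
  case (1 x y zs)
  define l where "l = last (y # zs)"
  let ?D = "sym_diff (P y) (P l)"
  have IH: "?D \<subseteq> K" "comp y = comp l" "path_edges (y # zs) = ed ` ?D"
    using 1 unfolding l_def by auto
  obtain k where k: "k \<in> K" "ed k = {x, y}"
    using 1(4,5) by (auto simp: edges_def doubleton_eq_iff)
  note e = edge_ends[OF k]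
  have sub: "\<Union>(path_edges ys) \<subseteq> set ys" for ys :: "nat list"
    by (induction ys rule: path_edges.induct) auto
  have "{x, y} \<notin> path_edges (y # zs)"
    using sub[of "y # zs"] 1(3) by auto
  then have "k \<notin> ?D" using k(2) IH(3) by auto
  then have D: "sym_diff (P x) (P l) = insert k ?D"
    by (rule sym_diff_insert[OF e(2)])
  have "sym_diff (P x) (P l) \<subseteq> K \<and> comp x = comp l \<and>
      path_edges (x # y # zs) = ed ` sym_diff (P x) (P l)"
    unfolding D path_edges.simps IH(3) using IH(1,2) k e(1) by simp
  then show ?case by (simp add: l_def)
qed auto

lemma cycle_through_hub:
  assumes "is_cycle edges C"
  obtains a b where "a \<in> N" "b \<in> N" "a \<noteq> b" "comp a = comp b"
    "C = {{0, a}, {0, b}} \<union> ed ` sym_diff (P a) (P b)"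
    "card C = 2 + card (sym_diff (P a) (P b))"
proof -
  obtain vs where vs: "length vs \<ge> 3" "distinct vs" "C = cycle_edges vs" "C \<subseteq> edges"
    using assms unfolding is_cycle_def by blast
  have "0 \<in> set vs"
  proof (rule ccontr)
    assume 0: "0 \<notin> set vs"
    obtain x y z zs where w: "vs = x # y # z # zs"
      using vs(1) by (auto simp: Suc_le_length_iff numeral_3_eq_3)
    \<comment> \<open>The closing edge alone accounts for the difference of \<open>P\<close> between
      the ends of \<open>vs\<close>, so the path \<open>vs\<close> would consist of that one edge,
      although it has at least three vertices.\<close>
    let ?l = "last vs"
    have "path_edges (vs @ [x]) = path_edges vs \<union> {{?l, x}}"
      using path_edges_snoc[of vs] w by simp
    then have C: "path_edges vs \<subseteq> edges" "{?l, x} \<in> edges"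
      using vs(3,4) w by (auto simp: cycle_edges_Cons)
    note path = path_avoiding_hub[OF _ vs(2) 0 C(1)]
    have "?l \<in> set vs" "x \<in> set vs" using w by auto
    then have "?l \<noteq> 0" "x \<noteq> 0" using 0 by metis+
    then obtain k where k: "k \<in> K" "ed k = {?l, x}"
      using C(2) by (auto simp: edges_def doubleton_eq_iff)
    have "sym_diff (P x) (P ?l) = {k}"
      using edge_ends(2)[OF k] by blast
    then have "path_edges vs = {{?l, x}}" using path k(2) w by simp
    then have "{x, y} = {?l, x}" by (simp add: w)
    then have "y = ?l" by (auto simp: doubleton_eq_iff)
    then show False using vs(2) w by (auto split: if_splits)
  qed
  then obtain w where w: "C = cycle_edges (0 # w)" "set vs = set (0 # w)" "length vs = length (0 # w)"
    using cycle_edges_rotate_to[of 0 vs] vs(3) by metis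
  have dist: "distinct (0 # w)"
    using vs(2) w(2,3) by (metis card_distinct distinct_card)
  have len: "length w \<ge> 2" using vs(1) w(3) by simp
  then have ne: "w \<noteq> []" by auto
  let ?a = "hd w" and ?b = "last w"
  have ab: "?a \<noteq> ?b"
    using dist len by (cases w) auto
  have "path_edges (0 # w @ [0]) = insert {0, ?a} (path_edges (w @ [0]))"
    using ne by (cases w) auto
  moreover have "path_edges (w @ [0]) = insert {?b, 0} (path_edges w)"
    using path_edges_snoc[OF ne] .
  ultimately have C: "C = {{0, ?a}, {0, ?b}} \<union> path_edges w"
    by (auto simp: w(1) cycle_edges_Cons insert_commute)
  have path: "sym_diff (P ?a) (P ?b) \<subseteq> K" "comp ?a = comp ?b"
      "path_edges w = ed ` sym_diff (P ?a) (P ?b)"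
    using path_avoiding_hub[OF ne] dist vs(4) C by auto
  have N: "a \<in> N" if "{0, a} \<in> edges" for a
    using that edge hub_notin by (auto simp: edges_def doubleton_eq_iff)
  have card: "card (path_edges w) = card (sym_diff (P ?a) (P ?b))"
    using path(1,3) inj_on_ed by (metis card_image inj_on_subset)
  have fin: "finite (path_edges xs)" for xs :: "nat list"
    by (induction xs rule: path_edges.induct) auto
  have disj: "{{0, ?a}, {0, ?b}} \<inter> path_edges w = {}"
    using path(1) edge unfolding path(3) by fastforce
  have "{0, ?a} \<noteq> {0, ?b}" using ab by (metis doubleton_eq_iff)
  then have "card {{0, ?a}, {0, ?b}} = 2" by simp
  moreover have "card C = card {{0, ?a}, {0, ?b}} + card (path_edges w)"
    unfolding C by (rule card_Un_disjoint[OF _ fin disj]) simp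
  ultimately have "card C = 2 + card (sym_diff (P ?a) (P ?b))"
    using card by simp
  moreover have "?a \<in> N" "?b \<in> N" using N vs(4) C by auto
  ultimately show thesis using that[of ?a ?b] ab path C by auto
qed

end

subsection \<open>Caterpillars\<close>

locale caterpillars =
  fixes B :: "'b set" and m :: "'b \<Rightarrow> nat" and r s :: "'b \<Rightarrow> nat \<Rightarrow> nat"
  assumes finite_B: "finite B"
    and rim_0: "b \<in> B \<Longrightarrow> r b 0 = 0"
    and rim_pos: "b \<in> B \<Longrightarrow> 0 < i \<Longrightarrow> i \<le> m b \<Longrightarrow> 0 < r b i"
    and spoke_pos: "b \<in> B \<Longrightarrow> i \<le> m b \<Longrightarrow> 0 < s b i"
begin

text \<open>
  The tree of \<^term>\<open>b\<close> has columns \<^term>\<open>i \<le> m b\<close>: a path that leaves column \<^term>\<open>i - 1\<close> at position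
  \<^term>\<open>r b (i - 1)\<close>, runs for \<^term>\<open>r b i\<close> steps along the rim, and then along a spoke of length
  \<^term>\<open>s b i\<close>, whose last edge goes to the hub. Position 0 exists only in column 0; it is the root.
\<close>

definition verts :: "('b \<times> nat \<times> nat) set" where
  "verts = (SIGMA b:B. SIGMA i:{..m b}. {min i 1..<r b i + s b i})"

fun par :: "'b \<times> nat \<times> nat \<Rightarrow> 'b \<times> nat \<times> nat" where
  "par (b, i, p) = (if 0 < i \<and> p = 1 then (b, i - 1, r b (i - 1)) else (b, i, p - 1))"

text \<open>The non-root vertices on the way to the root, each standing for the edge to its parent.
  This is the \<open>P\<close> of \<open>hub_forest\<close> with index set \<open>inner\<close>. An
  earlier column contributes only its rim.\<close>

fun anc :: "'b \<times> nat \<times> nat \<Rightarrow> ('b \<times> nat \<times> nat) set" where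
  "anc (b, i, p) = {b} \<times> ({i} \<times> {1..p} \<union> (SIGMA q:{..<i}. {1..r b q}))"

definition inner :: "('b \<times> nat \<times> nat) set" where
  "inner = {v \<in> verts. snd (snd v) \<noteq> 0}"

definition leaf :: "'b \<Rightarrow> nat \<Rightarrow> 'b \<times> nat \<times> nat" where
  "leaf b i = (b, i, r b i + s b i - 1)"

definition spots :: "('b \<times> nat) set" where
  "spots = (SIGMA b:B. {..m b})"

definition len :: "'b \<Rightarrow> nat \<Rightarrow> nat \<Rightarrow> nat" where
  "len b i j = s b i + s b j + (\<Sum>q\<in>{i<..j}. r b q)"

lemma finite_verts: "finite verts"
  unfolding verts_def using finite_B by auto

lemma leaf_in_verts:
  assumes "b \<in> B" "i \<le> m b"
  shows "leaf b i \<in> verts"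
proof (cases "i = 0")
  case True
  then show ?thesis using assms spoke_pos[OF assms] by (auto simp: verts_def leaf_def)
next
  case False
  then show ?thesis using assms spoke_pos[OF assms] rim_pos[OF assms(1) _ assms(2)]
    by (auto simp: verts_def leaf_def)
qed

lemma par_inner:
  assumes "v \<in> inner"
  shows "par v \<in> verts" "fst (par v) = fst v" "sym_diff (anc v) (anc (par v)) = {v}"
proof -
  obtain b i p where v: "v = (b, i, p)" by (cases v) auto
  have b: "b \<in> B" "i \<le> m b" "0 < p" "p < r b i + s b i"
    using assms by (auto simp: v inner_def verts_def)
  show "fst (par v) = fst v" by (simp add: v)
  show "par v \<in> verts"
  proof (cases "0 < i \<and> p = 1")
    case True
    then have i1: "i - 1 \<le> m b" using b by auto
    have "min (i - 1) 1 \<le> r b (i - 1)"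
      using rim_pos[OF b(1) _ i1] by (cases "i - 1 = 0") auto
    then show ?thesis using True b(1) i1 spoke_pos[OF b(1) i1] by (auto simp: v verts_def)
  next
    case False
    then show ?thesis using b by (auto simp: v verts_def min_def)
  qed
  show "sym_diff (anc v) (anc (par v)) = {v}"
  proof (cases "0 < i \<and> p = 1")
    case True
    then have "{..<i} = insert (i - 1) {..<i - 1}" by auto
    then show ?thesis using True by (auto simp: v)
  next
    case False
    then show ?thesis using b by (auto simp: v)
  qed
qed

text \<open>The two root paths share everything before column \<open>i\<close> and the rim of column
  \<open>i\<close>. What is left is the spoke of \<open>i\<close> (\<open>?X\<close>), the rims
  strictly between (\<open>?Y\<close>) and all of column \<open>j\<close> (\<open>?Z\<close>). The 2
  counts the hub edges that end the two spokes.\<close>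

lemma card_path:
  assumes "b \<in> B" "i < j" "j \<le> m b"
  shows "2 + card (sym_diff (anc (leaf b i)) (anc (leaf b j))) = len b i j"
proof -
  have i: "0 < s b i" and j: "0 < s b j" "0 < r b j"
    using assms spoke_pos rim_pos by auto
  let ?X = "{i} \<times> {r b i + 1..r b i + s b i - 1}" and ?Y = "SIGMA q:{i<..<j}. {1..r b q}"
    and ?Z = "{j} \<times> {1..r b j + s b j - 1}"
  have "sym_diff (anc (leaf b i)) (anc (leaf b j)) = {b} \<times> (?X \<union> ?Y \<union> ?Z)" (is "?L = ?R")
  proof (rule set_eqI)
    fix z :: "'b \<times> nat \<times> nat"
    obtain b' q p where z: "z = (b', q, p)" by (cases z) auto
    show "z \<in> ?L \<longleftrightarrow> z \<in> ?R"
      using i assms(2) by (cases q i rule: linorder_cases; cases q j rule: linorder_cases)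
        (auto simp: z leaf_def)
  qed
  moreover have "card (?X \<union> ?Y \<union> ?Z) = card ?X + card ?Y + card ?Z"
    using assms(2) by (subst card_Un_disjoint; (subst card_Un_disjoint)?) auto
  moreover have "{i<..j} = insert j {i<..<j}" using assms(2) by auto
  then have "(\<Sum>q\<in>{i<..j}. r b q) = (\<Sum>q\<in>{i<..<j}. r b q) + r b j" by simp
  ultimately show ?thesis using i j by (simp add: card_cartesian_product len_def)
qed

text \<open>Every column but the first lacks position 0, so a fan has \<open>m b\<close> fewer
  non-hub vertices than edges.\<close>

lemma card_verts: "card verts + (\<Sum>b\<in>B. m b) = (\<Sum>b\<in>B. \<Sum>i\<le>m b. r b i + s b i)"
proof -
  have "card (SIGMA i:{..m b}. {min i 1..<r b i + s b i}) + m b = (\<Sum>i\<le>m b. r b i + s b i)"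
    if b: "b \<in> B" for b
  proof -
    have "(\<Sum>i\<le>k. r b i + s b i - min i 1) + k = (\<Sum>i\<le>k. r b i + s b i)" if "k \<le> m b" for k
      using that
    proof (induction k)
      case (Suc k)
      then show ?case using rim_pos[OF b, of "Suc k"] by simp
    qed simp
    then show ?thesis by (simp add: card_SigmaI)
  qed
  moreover have "card verts = (\<Sum>b\<in>B. card (SIGMA i:{..m b}. {min i 1..<r b i + s b i}))"
    unfolding verts_def using finite_B by (subst card_SigmaI) auto
  ultimately show ?thesis by (simp flip: sum.distrib)
qed

lemma card_inner: "card inner + card B = card verts"
proof -
  have eq: "verts - inner = (\<lambda>b. (b, 0, 0)) ` B"
    using rim_0 spoke_pos by (fastforce simp: verts_def inner_def)
  have "card (verts - inner) = card B"
    unfolding eq by (rule card_image) (auto simp: inj_on_def)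
  moreover have "inner \<subseteq> verts" by (auto simp: inner_def)
  ultimately show ?thesis using finite_verts
    by (metis card_Diff_subset card_mono finite_subset le_add_diff_inverse)
qed

text \<open>The hub is 0 and \<open>enc\<close> numbers the tree vertices from 1. By
  \<open>cycle_through_hub\<close> and \<open>card_path\<close>, a cycle is fixed by a triple
  \<open>(b, i, j)\<close> and has length \<open>len b i j\<close>, so injectivity suffices. There
  is one edge per element of \<open>inner\<close> and one hub edge per element of
  \<open>spots\<close>.\<close>

lemma ex_graph:
  assumes inj: "inj_on (\<lambda>(b, i, j). len b i j) {(b, i, j). b \<in> B \<and> i < j \<and> j \<le> m b}"
  shows "\<exists>E. simple_graph_on (card verts + 1) E \<and> distinct_cycle_lengths E \<and>
    card E = card verts + (\<Sum>b\<in>B. m b)"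
proof -
  obtain enc where enc: "bij_betw enc verts {1..card verts}"
    using finite_same_card_bij[OF finite_verts, of "{1..card verts}"] by auto
  define dec where "dec = inv_into verts enc"
  have dec: "dec (enc v) = v" if "v \<in> verts" for v
    using that enc unfolding dec_def bij_betw_def by simp
  have enc_range: "0 < enc v" "enc v \<le> card verts" if "v \<in> verts" for v
    using that enc unfolding bij_betw_def by fastforce+
  have enc_eq: "enc u = enc v \<longleftrightarrow> u = v" if "u \<in> verts" "v \<in> verts" for u v
    using that enc unfolding bij_betw_def inj_on_def by blast
  define ed where "ed v = {enc v, enc (par v)}" for v
  define P where "P u = anc (dec u)" for u
  define comp where "comp u = fst (dec u)" for u
  define N where "N = (\<lambda>(b, i). enc (leaf b i)) ` spots"
  have leaf: "leaf b i \<in> verts" if "(b, i) \<in> spots" for b i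
    using that leaf_in_verts by (auto simp: spots_def)
  have inner_verts: "v \<in> verts" if "v \<in> inner" for v
    using that by (simp add: inner_def)
  interpret hub_forest inner ed P comp N
  proof
    fix v assume v: "v \<in> inner"
    note par = par_inner[OF v] and v' = inner_verts[OF v]
    have "0 \<notin> ed v" using enc_range par(1) v' by (auto simp: ed_def)
    moreover have "sym_diff (P (enc v)) (P (enc (par v))) = {v}"
      using par(1,3) v' by (simp add: P_def dec)
    moreover have "comp (enc v) = comp (enc (par v))"
      using par(1,2) v' by (simp add: comp_def dec)
    ultimately show "0 \<notin> ed v \<and> (\<exists>u w. ed v = {u, w} \<and> comp u = comp w \<and>
        sym_diff (P u) (P w) = {v})"
      unfolding ed_def by blast
  next
    have "enc (leaf b i) \<noteq> 0" if "(b, i) \<in> spots" for b i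
      using enc_range(1)[OF leaf[OF that]] by simp
    then show "0 \<notin> N" by (force simp: N_def)
  qed
  have "simple_graph_on (card verts + 1) edges"
    unfolding simple_graph_on_def
  proof
    fix e assume "e \<in> edges"
    then consider v where "v \<in> inner" "e = ed v" | b i where "(b, i) \<in> spots" "e = {0, enc (leaf b i)}"
      unfolding edges_def by (auto simp: N_def)
    then show "e \<in> {e. \<exists>u v. u \<noteq> v \<and> u < card verts + 1 \<and> v < card verts + 1 \<and> e = {u, v}}"
    proof cases
      case (1 v)
      note par = par_inner[OF 1(1)] and v = inner_verts[OF 1(1)]
      have "v \<noteq> par v" using par(3) by auto
      then have "enc v \<noteq> enc (par v)" using enc_eq par(1) v by auto
      moreover have "enc v < card verts + 1" "enc (par v) < card verts + 1"
        using enc_range(2)[OF v] enc_range(2)[OF par(1)] by auto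
      ultimately show ?thesis unfolding 1(2) ed_def by blast
    next
      case (2 b i)
      have "0 \<noteq> enc (leaf b i)" "enc (leaf b i) < card verts + 1"
        using enc_range[OF leaf[OF 2(1)]] by auto
      then show ?thesis unfolding 2(2) by auto
    qed
  qed
  moreover have "distinct_cycle_lengths edges"
  proof -
    have cyc: "\<exists>b i j. b \<in> B \<and> i < j \<and> j \<le> m b \<and> card C = len b i j \<and>
        C = {{0, enc (leaf b i)}, {0, enc (leaf b j)}} \<union>
          ed ` sym_diff (anc (leaf b i)) (anc (leaf b j))"
      if C: "is_cycle edges C" for C
    proof -
      obtain x y where xy: "x \<in> N" "y \<in> N" "x \<noteq> y" "comp x = comp y"
          "C = {{0, x}, {0, y}} \<union> ed ` sym_diff (P x) (P y)"
          "card C = 2 + card (sym_diff (P x) (P y))"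
        using cycle_through_hub[OF C] .
      obtain b i b' j where bi: "(b, i) \<in> spots" "x = enc (leaf b i)"
          and bj: "(b', j) \<in> spots" "y = enc (leaf b' j)"
        using xy(1,2) by (auto simp: N_def)
      have P: "P x = anc (leaf b i)" "P y = anc (leaf b' j)"
        using dec leaf bi bj by (auto simp: P_def)
      have b': "b' = b"
        using xy(4) dec leaf bi bj by (auto simp: comp_def leaf_def)
      have bm: "b \<in> B" "i \<le> m b" "j \<le> m b" using bi bj b' by (auto simp: spots_def)
      have "i \<noteq> j" using xy(3) bi bj b' by auto
      then consider "i < j" | "j < i" by linarith
      then show ?thesis
      proof cases
        case 1
        then show ?thesis using xy bm P bi bj b' card_path[of b i j] by auto
      next
        case 2
        have "C = {{0, y}, {0, x}} \<union> ed ` sym_diff (P y) (P x)"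
          using xy(5) by (simp add: insert_commute Un_commute)
        moreover have "card C = 2 + card (sym_diff (P y) (P x))"
          using xy(6) by (simp add: Un_commute)
        ultimately show ?thesis using 2 bm P bi bj b' card_path[of b j i] by auto
      qed
    qed
    show ?thesis
      unfolding distinct_cycle_lengths_def
    proof (intro allI impI notI)
      fix C D assume "is_cycle edges C \<and> is_cycle edges D \<and> C \<noteq> D" and eq: "card C = card D"
      then have C: "is_cycle edges C" and D: "is_cycle edges D" and ne: "C \<noteq> D" by auto
      obtain b i j where 1: "b \<in> B" "i < j" "j \<le> m b" "card C = len b i j"
        "C = {{0, enc (leaf b i)}, {0, enc (leaf b j)}} \<union>
          ed ` sym_diff (anc (leaf b i)) (anc (leaf b j))" using cyc[OF C] by blast
      obtain b' i' j' where 2: "b' \<in> B" "i' < j'" "j' \<le> m b'" "card D = len b' i' j'"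
        "D = {{0, enc (leaf b' i')}, {0, enc (leaf b' j')}} \<union>
          ed ` sym_diff (anc (leaf b' i')) (anc (leaf b' j'))" using cyc[OF D] by blast
      have "(b, i, j) = (b', i', j')"
        by (rule inj_onD[OF inj]) (use 1 2 eq in auto)
      then show False using ne 1(5) 2(5) by simp
    qed
  qed
  moreover have "card edges = card verts + (\<Sum>b\<in>B. m b)"
  proof -
    have fin: "finite inner" "finite spots"
      using finite_verts finite_B by (auto simp: inner_def spots_def)
    have "card (ed ` inner) = card inner" by (rule card_image[OF inj_on_ed])
    moreover have "(\<lambda>a. {0, a}) ` N = (\<lambda>(b, i). {0, enc (leaf b i)}) ` spots"
      by (force simp: N_def)
    moreover have "inj_on (\<lambda>(b, i). {0, enc (leaf b i)}) spots"
    proof (rule inj_onI, clarify)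
      fix b i b' i' assume "(b, i) \<in> spots" "(b', i') \<in> spots"
        "{0, enc (leaf b i)} = {0, enc (leaf b' i')}"
      then have "leaf b i = leaf b' i'"
        using enc_eq[of "leaf b i" "leaf b' i'"] leaf by (auto simp: doubleton_eq_iff)
      then show "b = b' \<and> i = i'" by (simp add: leaf_def)
    qed
    then have "card ((\<lambda>(b, i). {0, enc (leaf b i)}) ` spots) = card spots"
      by (rule card_image)
    moreover have "ed ` inner \<inter> (\<lambda>a. {0, a}) ` N = {}"
      using edge by blast
    ultimately have "card edges = card inner + card spots"
      unfolding edges_def using fin by (subst card_Un_disjoint) (auto simp: N_def)
    moreover have "card spots = (\<Sum>b\<in>B. m b) + card B"
      unfolding spots_def using finite_B by (simp add: card_SigmaI sum_Suc)
    ultimately show ?thesis using card_inner by simp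
  qed
  ultimately show ?thesis by blast
qed

end

subsection \<open>The families of fans\<close>

lemma f_ge:
  assumes "simple_graph_on n E" "distinct_cycle_lengths E"
  shows "f n \<ge> card E"
proof -
  have "{e. \<exists>u v. u \<noteq> v \<and> u < n \<and> v < n \<and> e = {u, v}} \<subseteq> Pow {..<n}" by auto
  then have "{E. simple_graph_on n E \<and> distinct_cycle_lengths E} \<subseteq> Pow (Pow {..<n})"
    unfolding simple_graph_on_def by blast
  then have "finite {E. simple_graph_on n E \<and> distinct_cycle_lengths E}"
    by (rule finite_subset) simp
  then show ?thesis
    unfolding f_def using assms by (intro Max_ge) auto
qed

section \<open>Linear forms and the table of fans\<close>

type_synonym form = "nat \<times> nat \<times> nat"

text \<open>One form describes a length throughout a family: \<open>h\<close> is the common scale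
  and \<open>k\<close> numbers the members.\<close>

fun val :: "form \<Rightarrow> nat \<Rightarrow> nat \<Rightarrow> nat" where
  "val (a, b, c) h k = a * h + b * k + c"

fun plus_form :: "form \<Rightarrow> form \<Rightarrow> form" where
  "plus_form (a, b, c) (a', b', c') = (a + a', b + b', c + c')"

definition sum_form :: "form list \<Rightarrow> form" where
  "sum_form fs = foldr plus_form fs (0, 0, 0)"

text \<open>
  The pairs are (rim, spoke). The three large fans were found by a computer search that maximises
  the ratio (excess edges)\<open>\<^sup>2\<close> / (vertices); the two-column fans are single cycles, one for
  each \<open>form_key\<close> \<open>(q, e)\<close> (defined below) with \<open>q < 15\<close> that the large fans leave unused.
\<close>

definition fans :: "(form \<times> form) list list" where
  "fans =
    [[((0, 0, 0), (8, 1, 0)), ((7, 0, 0), (11, 1, 1)), ((6, 0, 0), (9, 1, 1)),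
      ((17, 0, 0), (14, 1, 0)), ((10, 0, 0), (14, 1, 1)), ((4, 0, 0), (4, 1, 0))],
     [((0, 0, 0), (7, 1, 0)), ((7, 0, 0), (10, 1, 1)), ((12, 0, 0), (12, 1, 0)),
      ((2, 0, 0), (8, 1, 0)), ((19, 0, 0), (15, 1, 0)), ((6, 0, 0), (7, 1, 0))],
     [((0, 0, 0), (7, 1, 1)), ((7, 0, 0), (6, 1, 1)), ((14, 0, 0), (8, 1, 0)),
      ((12, 0, 0), (14, 1, 0)), ((5, 0, 0), (5, 1, 0))]] @
    map (\<lambda>q. [((0, 0, 0), (0, 0, 1)), ((0, 0, 1), (q - q mod 2, 2, q mod 2 + 2))]) ([0..<20] @ [21])"

text \<open>The symbolic counterpart of \<open>len\<close>, with a list in place of the index set so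
  that it can be evaluated.\<close>

definition len_form :: "(form \<times> form) list \<Rightarrow> nat \<Rightarrow> nat \<Rightarrow> form" where
  "len_form fan i j = plus_form (snd (fan ! i))
     (plus_form (snd (fan ! j)) (sum_form (map (\<lambda>q. fst (fan ! q)) [Suc i..<Suc j])))"

definition spans :: "(nat \<times> nat \<times> nat) list" where
  "spans = [(g, i, j). g \<leftarrow> [0..<length fans], i \<leftarrow> [0..<length (fans ! g)],
     j \<leftarrow> [Suc i..<length (fans ! g)]]"

text \<open>
  With \<^term>\<open>h = K + 2\<close> and \<^term>\<open>k < K\<close>, a length of the form \<^term>\<open>(a, 2, c)\<close> with even \<^term>\<open>a\<close> and
  \<^term>\<open>c \<le> 5\<close> has quotient \<^term>\<open>a div 2\<close> and remainder \<^term>\<open>2 * k + c\<close> modulo \<^term>\<open>2 * h\<close>,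
  so the length determines the key.
\<close>

definition form_key :: "form \<Rightarrow> nat \<times> nat" where
  "form_key = (\<lambda>(a, b, c). (a div 2, c mod 2))"

lemma fans_ok:
  "list_all (\<lambda>fan. length fan \<ge> 1 \<and> fst (fan ! 0) = (0, 0, 0) \<and>
     list_all (\<lambda>(a, b, c). a + c > 0) (map snd fan) \<and>
     list_all (\<lambda>(a, b, c). a + c > 0) (map fst (tl fan))) fans"
  by code_simp

text \<open>The value 5 comes from the single cycles: the one for \<open>q\<close> has length form
  \<open>(q - q mod 2, 2, q mod 2 + 4)\<close>, hence key \<open>(q div 2, q mod 2)\<close>.\<close>

lemma spans_ok:
  "list_all (\<lambda>(g, i, j). case len_form (fans ! g) i j of (a, b, c) \<Rightarrow>
     even a \<and> b = 2 \<and> c \<le> 5) spans"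
  by code_simp

lemma distinct_keys:
  "distinct (map (\<lambda>(g, i, j). form_key (len_form (fans ! g) i j)) spans)"
  by code_simp

text \<open>The members numbered \<open>k\<close> of all families together have
  \<open>487 * h + 59 * k + 101\<close> edges and 35 fewer non-hub vertices.\<close>

lemma fans_total:
  "sum_form (concat (map (\<lambda>fan. map fst fan @ map snd fan) fans)) = (487, 59, 101)"
  "sum_list (map (\<lambda>fan. length fan - 1) fans) = 35"
  "length fans = 24"
  by code_simp+

lemma val_plus_form [simp]: "val (plus_form x y) h k = val x h k + val y h k"
  by (cases x; cases y) (simp add: algebra_simps)

lemma val_sum_form: "val (sum_form fs) h k = (\<Sum>x\<leftarrow>fs. val x h k)"
  by (induction fs) (auto simp: sum_form_def)

lemma val_pos: "0 < h \<Longrightarrow> case x of (a, b, c) \<Rightarrow> a + c > 0 \<Longrightarrow> val x h k > 0"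
  by (cases x) auto

lemma sum_list_map_concat: "sum_list (map G (concat xss)) = (\<Sum>xs\<leftarrow>xss. sum_list (map G xs))"
  by (induction xss) auto

lemma sum_list_upt_conv_sum: "(\<Sum>i\<leftarrow>[a..<b]. g i) = (\<Sum>i\<in>{a..<b}. g i)"
  for g :: "nat \<Rightarrow> nat"
  by (simp add: interv_sum_list_conv_sum_set_nat)

text \<open>The bound on \<open>n\<close> counts the hub and the vertices of all fans for
  \<open>h = K + 2\<close>, with \<open>66 = 101 - 35\<close>. Strictness leaves at least one vertex
  for padding.\<close>

lemma f_ge_fans:
  fixes n K :: nat
  assumes K: "0 < K" and n: "487 * (K + 2) * K + (\<Sum>k<K. 59 * k) + 66 * K + 1 < n"
  shows "f n \<ge> n - 1 + 35 * K"
proof -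
  define h where "h = K + 2"
  define rest where "rest = n - 1 - (487 * h * K + (\<Sum>k<K. 59 * k) + 66 * K)"
  \<comment> \<open>The member \<open>(24, 0)\<close> is a bare path that pads the graph to \<open>n\<close> vertices.\<close>
  define B where "B = {..<24::nat} \<times> {..<K} \<union> {(24, 0)}"
  define m where "m = (\<lambda>(g, k::nat). if g < 24 then length (fans ! g) - 1 else 0)"
  define r where "r = (\<lambda>(g, k) i. if g < 24 then val (fst (fans ! g ! i)) h k else 0)"
  define s where "s = (\<lambda>(g, k) i. if g < 24 then val (snd (fans ! g ! i)) h k else rest)"
  have h: "0 < h" by (simp add: h_def)
  have rest: "0 < rest" using n by (simp add: rest_def h_def)
  have fan: "length (fans ! g) \<ge> 1" "fst (fans ! g ! 0) = (0, 0, 0)"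
      "i < length (fans ! g) \<Longrightarrow> val (snd (fans ! g ! i)) h k > 0"
      "0 < i \<Longrightarrow> i < length (fans ! g) \<Longrightarrow> val (fst (fans ! g ! i)) h k > 0" if "g < 24" for g i k
  proof -
    note ok = fans_ok[unfolded list_all_length fans_total(3), rule_format, OF that]
    then show l: "length (fans ! g) \<ge> 1" and "fst (fans ! g ! 0) = (0, 0, 0)" by auto
    show "val (snd (fans ! g ! i)) h k > 0" if "i < length (fans ! g)"
      by (rule val_pos[OF h]) (use ok that in auto)
    show "val (fst (fans ! g ! i)) h k > 0" if "0 < i" "i < length (fans ! g)"
    proof (rule val_pos[OF h])
      have "i - 1 < length (tl (fans ! g))" "tl (fans ! g) ! (i - 1) = fans ! g ! i"
        using that l by (auto simp: nth_tl)
      then show "case fst (fans ! g ! i) of (a, b, c) \<Rightarrow> a + c > 0"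
        using ok by (metis length_map nth_map)
    qed
  qed
  interpret caterpillars B m r s
  proof
    show "finite B" by (simp add: B_def)
    show "r b 0 = 0" for b by (cases b) (auto simp: r_def fan(2))
    show "0 < r b i" if "b \<in> B" "0 < i" "i \<le> m b" for b i
    proof -
      obtain g k where b: "b = (g, k)" by (cases b) auto
      have g: "g < 24" using that by (auto simp: m_def b split: if_splits)
      then have "i < length (fans ! g)" using that(3) fan(1)[OF g] by (simp add: m_def b)
      then show ?thesis using fan(4)[OF g that(2)] g by (simp add: r_def b)
    qed
    show "0 < s b i" if "b \<in> B" "i \<le> m b" for b i
    proof -
      obtain g k where b: "b = (g, k)" by (cases b) auto
      show ?thesis
      proof (cases "g < 24")
        case True
        then have "i < length (fans ! g)" using that(2) fan(1)[OF True] by (simp add: m_def b)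
        then show ?thesis using fan(3)[OF True] True by (simp add: s_def b)
      qed (use rest in \<open>simp add: s_def b\<close>)
    qed
  qed
  have len: "len (g, k) i j = val (len_form (fans ! g) i j) h k" if "g < 24" for g k i j
  proof -
    have "{i<..j} = {Suc i..<Suc j}" by auto
    then show ?thesis
      using that by (simp add: len_def len_form_def val_sum_form comp_def sum_list_upt_conv_sum
          del: upt_Suc) (simp add: r_def s_def)
  qed
  have span: "(g, i, j) \<in> set spans" if "g < 24" "i < j" "j \<le> m (g, k)" for g i j k
    using that fan(1)[OF that(1)] by (simp add: spans_def fans_total(3) m_def) (rule bexI[of _ g], rule bexI[of _ i], auto)
  have dec: "\<exists>c. len (g, k) i j div (2 * h) = fst (form_key (len_form (fans ! g) i j)) \<and>
      len (g, k) i j mod (2 * h) = 2 * k + c \<and>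
      c mod 2 = snd (form_key (len_form (fans ! g) i j)) \<and>
      c = snd (snd (len_form (fans ! g) i j))"
    if "g < 24" "k < K" "i < j" "j \<le> m (g, k)" for g k i j
  proof -
    obtain a b c where abc: "len_form (fans ! g) i j = (a, b, c)" by (cases "len_form (fans ! g) i j")
    have ok: "even a" "b = 2" "c \<le> 5"
      using spans_ok span[OF that(1,3,4)] abc by (auto simp: list_all_iff)
    then obtain a' where a': "a = 2 * a'" by blast
    have "len (g, k) i j = (2 * k + c) + a' * (2 * h)"
      using len[OF that(1)] abc ok a' by simp
    \<comment> \<open>At most \<open>2 * (K - 1) + 5\<close>, which is below
      \<open>2 * (K + 2)\<close>; this fixes the choice of \<open>h\<close>.\<close>
    moreover have "2 * k + c < 2 * h" using that(2) ok by (simp add: h_def)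
    ultimately show ?thesis using abc a' by (simp add: form_key_def)
  qed
  have inj: "inj_on (\<lambda>(b, i, j). len b i j) {(b, i, j). b \<in> B \<and> i < j \<and> j \<le> m b}"
  proof (rule inj_onI)
    fix x y
    assume xy: "x \<in> {(b, i, j). b \<in> B \<and> i < j \<and> j \<le> m b}" "y \<in> {(b, i, j). b \<in> B \<and> i < j \<and> j \<le> m b}"
      "(\<lambda>(b, i, j). len b i j) x = (\<lambda>(b, i, j). len b i j) y"
    obtain g k i j g' k' i' j' where x: "x = ((g, k), i, j)" and y: "y = ((g', k'), i', j')"
      by (metis surj_pair)
    have *: "(g, k) \<in> B" "i < j" "j \<le> m (g, k)" "(g', k') \<in> B" "i' < j'" "j' \<le> m (g', k')"
      "len (g, k) i j = len (g', k') i' j'"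
      using xy unfolding x y by simp_all
    then have g: "g < 24" "g' < 24" by (auto simp: m_def split: if_splits)
    then have k: "k < K" "k' < K" using * by (auto simp: B_def)
    obtain c where c: "len (g, k) i j div (2 * h) = fst (form_key (len_form (fans ! g) i j))"
        "len (g, k) i j mod (2 * h) = 2 * k + c"
        "c mod 2 = snd (form_key (len_form (fans ! g) i j))"
        "c = snd (snd (len_form (fans ! g) i j))"
      using dec[OF g(1) k(1) *(2,3)] by blast
    obtain c' where c': "len (g', k') i' j' div (2 * h) = fst (form_key (len_form (fans ! g') i' j'))"
        "len (g', k') i' j' mod (2 * h) = 2 * k' + c'"
        "c' mod 2 = snd (form_key (len_form (fans ! g') i' j'))"
        "c' = snd (snd (len_form (fans ! g') i' j'))"
      using dec[OF g(2) k(2) *(5,6)] by blast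
    \<comment> \<open>Equal lengths give equal quotients and remainders, hence equal keys, hence the
      same span by \<open>distinct_keys\<close>. Then \<open>c = c'\<close>, and the remainder
      yields \<open>k = k'\<close>.\<close>
    have eq: "2 * k + c = 2 * k' + c'" using c(2) c'(2) *(7) by simp
    then have "c mod 2 = c' mod 2" by presburger
    then have "form_key (len_form (fans ! g) i j) = form_key (len_form (fans ! g') i' j')"
      using c(1,3) c'(1,3) *(7) by (simp add: prod_eq_iff)
    then have "(g, i, j) = (g', i', j')"
      using inj_onD[OF conjunct2[OF distinct_keys[unfolded distinct_map]], of "(g, i, j)" "(g', i', j')"]
        span[OF g(1) *(2,3)] span[OF g(2) *(5,6)] by simp
    then show "x = y" using eq c(4) c'(4) by (simp add: x y)
  qed
  have sum_B: "(\<Sum>b\<in>B. F b) = (\<Sum>k<K. \<Sum>g<24. F (g, k)) + F (24, 0)" for F :: "nat \<times> nat \<Rightarrow> nat"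
  proof -
    have "(\<Sum>b\<in>B. F b) = (\<Sum>b\<in>{..<24} \<times> {..<K}. F b) + F (24, 0)"
      unfolding B_def by (subst sum.union_disjoint) auto
    also have "(\<Sum>b\<in>{..<24} \<times> {..<K}. F b) = (\<Sum>k<K. \<Sum>g<24. F (g, k))"
      by (subst sum.swap) (simp add: sum.cartesian_product)
    finally show ?thesis .
  qed
  have sum_fans: "(\<Sum>g<24. G (fans ! g)) = (\<Sum>fan\<leftarrow>fans. G fan)" for G :: "(form \<times> form) list \<Rightarrow> nat"
    by (simp add: sum_list_sum_nth fans_total(3) atLeast0LessThan)
  have m: "(\<Sum>b\<in>B. m b) = 35 * K"
    using sum_fans[of "\<lambda>fan. length fan - 1"] fans_total(2) by (simp add: sum_B m_def)
  have nth_sum: "sum_list (map F xs) = (\<Sum>i = 0..<length xs. F (xs ! i))"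
    for F :: "form \<times> form \<Rightarrow> nat" and xs
    by (simp add: sum_list_sum_nth)
  have "(\<Sum>i\<le>m (g, k). r (g, k) i + s (g, k) i) =
      (\<Sum>x\<leftarrow>map fst (fans ! g) @ map snd (fans ! g). val x h k)" if g: "g < 24" for g k
  proof -
    have "{..m (g, k)} = {0..<length (fans ! g)}"
      using g fan(1)[OF g] by (auto simp: m_def)
    then show ?thesis using g by (simp add: r_def s_def sum.distrib nth_sum)
  qed
  then have "(\<Sum>g<24. \<Sum>i\<le>m (g, k). r (g, k) i + s (g, k) i) =
      (\<Sum>g<24. \<Sum>x\<leftarrow>map fst (fans ! g) @ map snd (fans ! g). val x h k)" for k
    by (intro sum.cong) auto
  also have "\<dots> k = val (487, 59, 101) h k" for k
    unfolding sum_fans[of "\<lambda>fan. \<Sum>x\<leftarrow>map fst fan @ map snd fan. val x h k"]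
      fans_total(1)[symmetric] val_sum_form
    by (simp only: sum_list_map_concat map_map comp_def)
  finally have "(\<Sum>b\<in>B. \<Sum>i\<le>m b. r b i + s b i) = (\<Sum>k<K. val (487, 59, 101) h k) + rest"
    by (simp add: sum_B m_def r_def s_def)
  also have "(\<Sum>k<K. val (487, 59, 101) h k) = 487 * h * K + (\<Sum>k<K. 59 * k) + 101 * K"
    by (simp add: sum.distrib)
  finally have "card verts + 1 = n"
    using card_verts m n by (simp add: rest_def h_def)
  then show ?thesis
    using ex_graph[OF inj] f_ge m by fastforce
qed

section \<open>Choice of \<open>K\<close> and numerical estimate\<close>

theorem mainTheorem1:
  fixes r t n :: nat
  assumes "r \<ge> 1"
    and "t = 27720 * r + 169"
    and "real n \<ge> 6911 / 16 * (real t)^2 + 514441 / 8 * real t - 3309665 / 16"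
  shows "f n \<ge> n + 32 * t - 1"
proof -
  \<comment> \<open>The quotient \<open>32 * t / 35\<close> rounded up, the least \<open>K\<close>
    whose excess \<open>35 * K\<close> reaches \<open>32 * t\<close>.\<close>
  define K where "K = (32 * t + 34) div 35"
  have K: "32 * t \<le> 35 * K" "35 * K \<le> 32 * t + 34" by (auto simp: K_def)
  have t: "27889 \<le> t" using assms(1,2) by simp
  have sum: "real (\<Sum>k<k'. 59 * k) = 59 * real k' * (real k' - 1) / 2" for k'
    by (induction k') (auto simp: field_simps)
  have K': "real K \<le> (32 * real t + 34) / 35" using of_nat_mono[OF K(2), where 'a = real] by simp
  \<comment> \<open>\<open>1033 / 2 = 487 + 59 / 2\<close> and
    \<open>2021 / 2 = 2 * 487 - 59 / 2 + 66\<close>.\<close>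
  have "real (487 * (K + 2) * K + (\<Sum>k<K. 59 * k) + 66 * K + 1) =
      1033 / 2 * (real K)^2 + 2021 / 2 * real K + 1"
    unfolding of_nat_add sum by (simp add: field_simps power2_eq_square)
  also have "\<dots> \<le> 1033 / 2 * ((32 * real t + 34) / 35)^2 + 2021 / 2 * ((32 * real t + 34) / 35) + 1"
    using K' by (intro add_mono mult_left_mono power_mono) auto
  also have "\<dots> < 6911 / 16 * (real t)^2 + 514441 / 8 * real t - 3309665 / 16"
  proof -
    \<comment> \<open>The claim with denominators cleared: both coefficients of powers of
      \<open>t\<close> are positive, and the linear term alone outweighs the constant.\<close>
    have "0 \<le> real t * (real t * 8151360)" by simp
    moreover have "27889 \<le> real t" using t by simp
    ultimately have "9146261216960 < real t * (real t * 8151360) + real t * 2742409210240"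
      by linarith
    then show ?thesis by (simp add: power2_eq_square field_simps)
  qed
  also have "\<dots> \<le> real n" by (rule assms(3))
  finally have "487 * (K + 2) * K + (\<Sum>k<K. 59 * k) + 66 * K + 1 < n"
    unfolding of_nat_less_iff .
  then have "f n \<ge> n - 1 + 35 * K"
    using K(1) t by (intro f_ge_fans) auto
  then show ?thesis using K(1) by simp
qed

end
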